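(* Let $\{(x_k,y_k,u_k)\}_{k}$ be an (infinite) sequence generated by the penalty algorithm described in the context, and let $\{\alpha_k\}_k$ be the associated sequence of penalty parameters. Then $\{\alpha_k\}_k$ is bounded and, thus, converges.
   Context: Setting and standing assumptions. All spaces are real. $\mathcal Y,\mathcal U,\mathcal V$ are Hilbert spaces, $\mathcal Y$ is continuously embedded in $\mathcal V$; $\mathcal U^*$ is identified with $\mathcal U$ and $\mathcal V^*$ with $\mathcal V$ (via Riesz), and $\mathcal Y^{**}$ with $\mathcal Y$; the embedding $\mathcal Y\hookrightarrow\mathcal V$ and its adjoint $\mathcal V\hookrightarrow\mathcal Y^*$ are suppressed in the notation. $F\colon\mathbb{R}^n\times\mathcal Y\times\mathcal U\to\mathbb{R}$ is continuously Fréchet differentiable and convex. $X_{\mathrm{ad}}\subset\mathbb{R}^n$ is nonempty, convex, compact. $A\in\mathcal L(\mathcal Y,\mathcal Y^* )$ is an isomorphism, $B\in\mathcal L(\mathcal U,\mathcal Y^* )$, $E\in\mathcal L(\mathbb{R}^n,\mathcal V)$ (linear continuous operators); so $A^*\in\mathcal L(\mathcal Y,\mathcal Y^* )$, $B^*\in\mathcal L(\mathcal Y,\mathcal U)$, $E^*\in\mathcal L(\mathcal V,\mathbb{R}^n)$. $U_{\mathrm{ad}}\subset\mathcal U$ is nonempty, closed, convex, bounded. $\sigma>0$ and $\varepsilon>0$ are fixed. Set $$f(x,y,u):=\tfrac12\|y-Ex\|_{\mathcal V}^2+\tfrac{\sigma}{2}\|u\|_{\mathcal U}^2,$$ so that $f'_x(x,y,u)=E^*(Ex-y)$,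 $f'_y(x,y,u)=y-Ex$, $f'_u(x,y,u)=\sigma u$. For $x\in\mathbb{R}^n$, the lower-level problem is $\min_{y,u} f(x,y,u)$ s.t. $Ay=Bu$, $u\in U_{\mathrm{ad}}$. It has a unique global minimizer $(y(x),u(x))\in\mathcal Y\times\mathcal U$; $\varphi(x):=f(x,y(x),u(x))$ is its optimal value. The mappings $x\mapsto y(x)$ and $x\mapsto u(x)$ are Lipschitz continuous. For a convex set $C$ in a Hilbert space identified with its dual, $N_C(\bar z)=\{z^*: \langle z^*,z-\bar z\rangle\le 0\ \forall z\in C\}$ if $\bar z\in C$, and $N_C(\bar z)=\emptyset$ otherwise; $\operatorname{proj}_C$ is the metric projection. Penalty algorithm. Parameters: $x_0\in X_{\mathrm{ad}}$, $\alpha_0>0$, $\gamma>1$, $\eta>0$, $\kappa\in(0,1)$. Set $V_{-1}:=\infty$. For $k=0,1,2,\dots$: (1) Given $x_k,\alpha_k$, find $(y_k,u_k,\lambda^p_k,\lambda^u_k)\in\mathcal Y\times\mathcal U\times\mathcal Y\times\mathcal U$ with $0=F'_y(x_k,y_k,u_k)+A^*\lambda^p_k+\alpha_kf'_y(x_k,y_k,u_k)$, $0=F'_u(x_k,y_k,u_k)-B^*\lambda^p_k+\lambda^u_k+\alpha_kf'_u(x_k,y_k,u_k)$, $0=Ay_k-Bu_k$, $\lambda^u_k\in N_{U_{\mathrm{ad}}}(u_k)$. (2) Compute $y(x_k)$, $\varphi(x_k)$ and set $V_k:=f(x_k,y_k,u_k)-\varphi(x_k)-\varepsilon$. (3) If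 $V_k\le0$, stop and return $(x_k,y_k,u_k)$. Otherwise set $\alpha_{k+1}:=\gamma\alpha_k$ if $V_k>\kappa V_{k-1}$, and $\alpha_{k+1}:=\alpha_k$ if not. (4) Set $w_k:=F'_x(x_k,y_k,u_k)+\alpha_{k+1}\bigl(f'_x(x_k,y_k,u_k)-E^*(Ex_k-y(x_k))\bigr)$ and $x_{k+1}:=\operatorname{proj}_{X_{\mathrm{ad}}}(x_k-\eta w_k)$. A "sequence generated by the algorithm" means an infinite one, i.e., the algorithm does not stop in step (3). *)

theory Defs
  imports "HOL-Analysis.Analysis"
begin

text \<open>
  Hilbert spaces are types of class \<open>{real_inner, complete_space}\<close>; the dual of \<open>'a\<close> is
  \<open>'a \<Rightarrow>\<^sub>L real\<close>.  The dual of \<open>'y\<close> is kept apart from \<open>'y\<close>, whereas the duals of \<open>'u\<close> and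
  \<open>real ^ 'n\<close> are identified with the spaces themselves by \<open>riesz\<close>.
\<close>

definition riesz :: "('a::real_inner \<Rightarrow>\<^sub>L real) \<Rightarrow> 'a" where
  "riesz \<phi> = (THE z. \<forall>h. blinfun_apply \<phi> h = z \<bullet> h)"

definition dual_operator ::
    "('a::real_normed_vector \<Rightarrow>\<^sub>L 'b::real_normed_vector) \<Rightarrow> ('b \<Rightarrow>\<^sub>L real) \<Rightarrow> ('a \<Rightarrow>\<^sub>L real)" where
  "dual_operator T \<phi> = \<phi> o\<^sub>L T"

definition bidual_embedding :: "'a::real_normed_vector \<Rightarrow> (('a \<Rightarrow>\<^sub>L real) \<Rightarrow>\<^sub>L real)" where
  "bidual_embedding p = Blinfun (\<lambda>\<phi>. blinfun_apply \<phi> p)"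

definition frechet_dual :: "('a::real_normed_vector \<Rightarrow> real) \<Rightarrow> 'a \<Rightarrow> ('a \<Rightarrow>\<^sub>L real)" where
  "frechet_dual g z = Blinfun (frechet_derivative g (at z))"

definition C1_frechet :: "('a::real_normed_vector \<Rightarrow> real) \<Rightarrow> bool" where
  "C1_frechet G \<longleftrightarrow>
     (\<exists>D :: 'a \<Rightarrow> ('a \<Rightarrow>\<^sub>L real).
        (\<forall>z. (G has_derivative blinfun_apply (D z)) (at z)) \<and> continuous_on UNIV D)"

definition deriv_x ::
    "('x::real_inner \<times> 'y::real_normed_vector \<times> 'u::real_normed_vector \<Rightarrow> real) \<Rightarrow>
     'x \<Rightarrow> 'y \<Rightarrow> 'u \<Rightarrow> 'x" where
  "deriv_x G x y u = riesz (frechet_dual (\<lambda>x'. G (x', y, u)) x)"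

definition deriv_y ::
    "('x::real_normed_vector \<times> 'y::real_normed_vector \<times> 'u::real_normed_vector \<Rightarrow> real) \<Rightarrow>
     'x \<Rightarrow> 'y \<Rightarrow> 'u \<Rightarrow> ('y \<Rightarrow>\<^sub>L real)" where
  "deriv_y G x y u = frechet_dual (\<lambda>y'. G (x, y', u)) y"

definition deriv_u ::
    "('x::real_normed_vector \<times> 'y::real_normed_vector \<times> 'u::real_inner \<Rightarrow> real) \<Rightarrow>
     'x \<Rightarrow> 'y \<Rightarrow> 'u \<Rightarrow> 'u" where
  "deriv_u G x y u = riesz (frechet_dual (\<lambda>u'. G (x, y, u')) u)"

definition normal_cone :: "'a::real_inner set \<Rightarrow> 'a \<Rightarrow> 'a set" where
  "normal_cone C z = (if z \<in> C then {w. \<forall>c\<in>C. w \<bullet> (c - z) \<le> 0} else {})"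

definition isomorphism :: "('a::real_normed_vector \<Rightarrow>\<^sub>L 'b::real_normed_vector) \<Rightarrow> bool" where
  "isomorphism T \<longleftrightarrow> (\<exists>S. S o\<^sub>L T = id_blinfun \<and> T o\<^sub>L S = id_blinfun)"


text \<open>\<open>J\<close> is the embedding of \<open>'y\<close> into \<open>'v\<close>.\<close>

definition lower_objective ::
    "('y::real_normed_vector \<Rightarrow>\<^sub>L 'v::real_inner) \<Rightarrow> ('x::real_normed_vector \<Rightarrow>\<^sub>L 'v) \<Rightarrow> real \<Rightarrow>
     'x \<times> 'y \<times> 'u::real_inner \<Rightarrow> real" where
  "lower_objective J E \<sigma> =
     (\<lambda>(x, y, u). 1/2 * (norm (blinfun_apply J y - blinfun_apply E x))\<^sup>2 + \<sigma>/2 * (norm u)\<^sup>2)"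

definition lower_feasible ::
    "('y::real_normed_vector \<Rightarrow>\<^sub>L ('y \<Rightarrow>\<^sub>L real)) \<Rightarrow> ('u::real_normed_vector \<Rightarrow>\<^sub>L ('y \<Rightarrow>\<^sub>L real)) \<Rightarrow>
     'u set \<Rightarrow> ('y \<times> 'u) set" where
  "lower_feasible A B U = {(y, u). blinfun_apply A y = blinfun_apply B u \<and> u \<in> U}"

definition lower_solution :: "('x \<times> 'y \<times> 'u \<Rightarrow> real) \<Rightarrow> ('y \<times> 'u) set \<Rightarrow> 'x \<Rightarrow> 'y \<times> 'u" where
  "lower_solution f S x = (THE z. z \<in> S \<and> (\<forall>z'\<in>S. f (x, z) \<le> f (x, z')))"

definition lower_value :: "('x \<times> 'y \<times> 'u \<Rightarrow> real) \<Rightarrow> ('y \<times> 'u) set \<Rightarrow> 'x \<Rightarrow> real" where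
  "lower_value f S x = f (x, lower_solution f S x)"

definition penalty_kkt ::
    "('x::real_normed_vector \<times> 'y::{real_inner,complete_space} \<times> 'u::{real_inner,complete_space} \<Rightarrow> real) \<Rightarrow>
     ('x \<times> 'y \<times> 'u \<Rightarrow> real) \<Rightarrow> ('y \<Rightarrow>\<^sub>L ('y \<Rightarrow>\<^sub>L real)) \<Rightarrow> ('u \<Rightarrow>\<^sub>L ('y \<Rightarrow>\<^sub>L real)) \<Rightarrow> 'u set \<Rightarrow>
     real \<Rightarrow> 'x \<Rightarrow> 'y \<Rightarrow> 'u \<Rightarrow> 'y \<Rightarrow> 'u \<Rightarrow> bool" where
  "penalty_kkt F f A B U \<alpha> x y u lp lu \<longleftrightarrow>
     0 = deriv_y F x y u + dual_operator A (bidual_embedding lp) + \<alpha> *\<^sub>R deriv_y f x y u \<and>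
     0 = deriv_u F x y u - riesz (dual_operator B (bidual_embedding lp)) + lu
           + \<alpha> *\<^sub>R deriv_u f x y u \<and>
     0 = blinfun_apply A y - blinfun_apply B u \<and>
     lu \<in> normal_cone U u"

text \<open>
  An infinite run: the stopping test fails in every iteration.
  The value \<open>V\<^sub>-\<^sub>1 = \<infinity>\<close> is handled in \<open>ereal\<close>.
\<close>

definition penalty_run ::
    "((real^'n) \<times> 'y::{real_inner,complete_space} \<times> 'u::{real_inner,complete_space} \<Rightarrow> real) \<Rightarrow>
     ('y \<Rightarrow>\<^sub>L ('y \<Rightarrow>\<^sub>L real)) \<Rightarrow> ('u \<Rightarrow>\<^sub>L ('y \<Rightarrow>\<^sub>L real)) \<Rightarrow>
     ((real^'n) \<Rightarrow>\<^sub>L 'v::{real_inner,complete_space}) \<Rightarrow> ('y \<Rightarrow>\<^sub>L 'v) \<Rightarrow>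
     (real^'n) set \<Rightarrow> 'u set \<Rightarrow> real \<Rightarrow> real \<Rightarrow> real \<Rightarrow> real \<Rightarrow> real \<Rightarrow>
     (nat \<Rightarrow> real^'n) \<Rightarrow> (nat \<Rightarrow> 'y) \<Rightarrow> (nat \<Rightarrow> 'u) \<Rightarrow> (nat \<Rightarrow> 'y) \<Rightarrow> (nat \<Rightarrow> 'u) \<Rightarrow>
     (nat \<Rightarrow> real) \<Rightarrow> bool" where
  "penalty_run F A B E J Xad Uad \<sigma> \<epsilon> \<gamma> \<eta> \<kappa> x y u lp lu \<alpha> \<longleftrightarrow>
     (let f = lower_objective J E \<sigma>;
          S = lower_feasible A B Uad;
          V = (\<lambda>k. f (x k, y k, u k) - lower_value f S (x k) - \<epsilon>);
          Vprev = (\<lambda>k. if k = 0 then \<infinity> else ereal (V (k - 1)));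
          w = (\<lambda>k. deriv_x F (x k) (y k) (u k)
                 + \<alpha> (Suc k) *\<^sub>R (deriv_x f (x k) (y k) (u k)
                     - adjoint (blinfun_apply E)
                         (blinfun_apply E (x k) - blinfun_apply J (fst (lower_solution f S (x k))))))
      in \<forall>k. penalty_kkt F f A B Uad (\<alpha> k) (x k) (y k) (u k) (lp k) (lu k) \<and>
             V k > 0 \<and>
             \<alpha> (Suc k) = (if ereal (V k) > ereal \<kappa> * Vprev k then \<gamma> * \<alpha> k else \<alpha> k) \<and>
             x (Suc k) = closest_point Xad (x k - \<eta> *\<^sub>R w k))"

end

theory Submission
  imports Defs
begin

text \<open>
  The system solved in step (1) characterises \<open>(y\<^sub>k, u\<^sub>k)\<close> as a global minimiser of
  \<open>F(x\<^sub>k, \<cdot>) + \<alpha>\<^sub>k f(x\<^sub>k, \<cdot>)\<close> on the lower-level feasible set, by convexity.  Comparing with the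
  lower-level solution gives
  \<open>\<alpha>\<^sub>k (f(x\<^sub>k, y\<^sub>k, u\<^sub>k) - \<phi>(x\<^sub>k)) \<le> F(x\<^sub>k, y(x\<^sub>k), u(x\<^sub>k)) - F(x\<^sub>k, y\<^sub>k, u\<^sub>k)\<close>.
  The right-hand side is bounded above by a constant: the solution map is continuous, so its graph
  over the compact set \<open>X\<^sub>a\<^sub>d\<close> is compact, and the convex function \<open>F\<close> has an affine minorant, so it
  is bounded below on bounded sets.  Since the stopping test fails, the bracket on the left
  exceeds \<open>\<epsilon>\<close>, and \<open>\<alpha>\<^sub>k\<close> is bounded.
\<close>

section \<open>Tangent inequality for convex functions\<close>

text \<open>Along the line through \<open>z\<close> and \<open>w\<close> the function becomes a
  convex function \<open>g\<close> of one real variable, with derivative \<open>D (w - z)\<close> at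
  0; the one-dimensional tangent inequality is evaluated at 1.\<close>

lemma convex_on_ge_tangent:
  fixes G :: "'a::real_normed_vector \<Rightarrow> real"
  assumes conv: "convex_on UNIV G" and der: "(G has_derivative D) (at z)"
  shows "G w \<ge> G z + D (w - z)"
proof -
  define g where "g t = G (z + t *\<^sub>R (w - z))" for t :: real
  have "convex_on UNIV g"
  proof (rule convex_onI)
    fix t x y :: real
    assume "0 < t" "t < 1"
    moreover have "z + ((1 - t) *\<^sub>R x + t *\<^sub>R y) *\<^sub>R (w - z)
        = (1 - t) *\<^sub>R (z + x *\<^sub>R (w - z)) + t *\<^sub>R (z + y *\<^sub>R (w - z))"
      by (simp add: algebra_simps)
    ultimately show "g ((1 - t) *\<^sub>R x + t *\<^sub>R y) \<le> (1 - t) * g x + t * g y"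
      unfolding g_def using convex_onD[OF conv, of t] by simp
  qed simp
  moreover have "(g has_real_derivative D (w - z)) (at 0 within UNIV)"
  proof -
    interpret D: bounded_linear D using der by (rule has_derivative_bounded_linear)
    have line: "((\<lambda>t::real. z + t *\<^sub>R (w - z)) has_derivative (\<lambda>t. t *\<^sub>R (w - z))) (at 0)"
      by (auto intro!: derivative_eq_intros)
    have "(g has_derivative (\<lambda>t. D (t *\<^sub>R (w - z)))) (at 0)"
      unfolding g_def
      by (rule has_derivative_compose[OF line]) (use der in simp)
    then show ?thesis
      by (simp add: has_field_derivative_def D.scaleR mult.commute[of "D (w - z)"] mult_commute_abs)
  qed
  ultimately have "g 1 - g 0 \<ge> D (w - z) * (1 - 0)"
    by (intro convex_on_imp_above_tangent[where A = UNIV]) simp_all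
  then show ?thesis by (simp add: g_def)
qed

section \<open>Metric projection and Riesz representation in Hilbert spaces\<close>

text \<open>Completeness takes the place of compactness: the sets \<open>S n\<close> of almost
  nearest points are closed, nested and of diameter tending to 0, so they share a point.\<close>

lemma distance_attains_inf_complete:
  fixes C :: "'a::{real_inner,complete_space} set"
  assumes "closed C" "convex C" "C \<noteq> {}"
  shows "\<exists>p\<in>C. \<forall>c\<in>C. dist a p \<le> dist a c"
proof -
  define d where "d = infdist a C"
  have d: "d \<ge> 0" "\<And>c. c \<in> C \<Longrightarrow> d \<le> dist a c"
    by (auto simp: d_def infdist_nonneg infdist_le)
  define S where "S n = {c \<in> C. dist a c \<le> d + 1 / real (Suc n)}" for n
  have "\<exists>p. \<forall>n. p \<in> S n"
  proof (rule decreasing_closed_nest)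
    show "closed (S n)" for n
    proof -
      have "S n = C \<inter> cball a (d + 1 / real (Suc n))" by (auto simp: S_def)
      then show ?thesis using assms by auto
    qed
    show "S n \<noteq> {}" for n
    proof -
      have "(INF c\<in>C. dist a c) < d + 1 / real (Suc n)"
        using assms by (simp add: d_def infdist_def)
      then obtain c where "c \<in> C" "dist a c < d + 1 / real (Suc n)"
        using assms by (subst (asm) cINF_less_iff) (auto intro!: bdd_belowI[of _ 0])
      then show ?thesis by (auto simp: S_def)
    qed
    show "S n \<subseteq> S m" if "m \<le> n" for m n
    proof -
      have "1 / real (Suc n) \<le> 1 / real (Suc m)" using that by (simp add: frac_le)
      then show ?thesis by (auto simp: S_def)
    qed
    show "\<exists>n. \<forall>x\<in>S n. \<forall>y\<in>S n. dist x y < e" if "e > 0" for e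
    proof -
      \<comment> \<open>This expression bounds the squared distance of any two points of
        \<open>S n\<close>. It comes from the parallelogram law, since their midpoint lies in
        \<open>C\<close> and hence at distance at least \<open>d\<close> from
        \<open>a\<close>.\<close>
      have "(\<lambda>n. 4 * (d + inverse (real (Suc n)))\<^sup>2 - 4 * d\<^sup>2) \<longlonglongrightarrow> 4 * (d + 0)\<^sup>2 - 4 * d\<^sup>2"
        by (intro tendsto_intros LIMSEQ_inverse_real_of_nat)
      then have "\<forall>\<^sub>F n in sequentially. 4 * (d + inverse (real (Suc n)))\<^sup>2 - 4 * d\<^sup>2 < e\<^sup>2"
        by (rule order_tendstoD) (use that in simp)
      then obtain n where n: "4 * (d + 1 / real (Suc n))\<^sup>2 - 4 * d\<^sup>2 < e\<^sup>2"
        by (auto simp: eventually_sequentially inverse_eq_divide)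
      have "dist x y < e" if xy: "x \<in> S n" "y \<in> S n" for x y
      proof -
        define m where "m = (1/2) *\<^sub>R x + (1/2) *\<^sub>R y"
        have "m \<in> C" unfolding m_def
          using xy assms(2) by (intro convexD) (auto simp: S_def)
        then have "d\<^sup>2 \<le> (dist a m)\<^sup>2" using d by (intro power_mono) auto
        moreover have "(dist a x)\<^sup>2 \<le> (d + 1 / real (Suc n))\<^sup>2" "(dist a y)\<^sup>2 \<le> (d + 1 / real (Suc n))\<^sup>2"
          using xy by (intro power_mono; simp add: S_def)+
        moreover have "(dist x y)\<^sup>2 = 2 * (dist a x)\<^sup>2 + 2 * (dist a y)\<^sup>2 - 4 * (dist a m)\<^sup>2"
          unfolding m_def dist_norm power2_norm_eq_inner
          by (simp add: algebra_simps inner_commute)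
        ultimately have "(dist x y)\<^sup>2 < e\<^sup>2" using n by linarith
        then show ?thesis using \<open>e > 0\<close> by (simp add: power2_less_imp_less)
      qed
      then show ?thesis by blast
    qed
  qed blast
  then obtain p where p: "\<And>n. p \<in> S n" by blast
  have "(\<lambda>n. d + inverse (real (Suc n))) \<longlonglongrightarrow> d + 0"
    by (intro tendsto_intros LIMSEQ_inverse_real_of_nat)
  then have "dist a p \<le> d + 0"
    by (rule LIMSEQ_le_const) (use p in \<open>auto simp: S_def inverse_eq_divide\<close>)
  then have "\<forall>c\<in>C. dist a p \<le> dist a c" using d by force
  then show ?thesis using p by (auto simp: S_def)
qed

text \<open>The obtuse-angle conditions at \<open>p\<close> and \<open>q\<close>, each tested with
  the other point, are added; Cauchy-Schwarz does the rest.\<close>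

lemma closest_points_nonexpansive:
  fixes C :: "'a::real_inner set"
  assumes "convex C" "closed C"
    and p: "p \<in> C" "\<forall>c\<in>C. dist a p \<le> dist a c" and q: "q \<in> C" "\<forall>c\<in>C. dist b q \<le> dist b c"
  shows "dist p q \<le> dist a b"
proof -
  have "(a - p) \<bullet> (q - p) \<le> 0" "(b - q) \<bullet> (p - q) \<le> 0"
    using any_closest_point_dot[OF assms(1,2) p(1) q(1) p(2)]
      any_closest_point_dot[OF assms(1,2) q(1) p(1) q(2)] .
  then have "(norm (p - q))\<^sup>2 \<le> (a - b) \<bullet> (p - q)"
    by (simp add: power2_norm_eq_inner algebra_simps inner_commute)
  also have "\<dots> \<le> norm (a - b) * norm (p - q)" by (rule norm_cauchy_schwarz)
  finally show ?thesis
    by (cases "p = q") (auto simp: dist_norm power2_eq_square)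
qed

text \<open>The point \<open>p\<close> nearest to 0 on the hyperplane where \<open>\<phi>\<close>
  equals 1 is orthogonal to the kernel of \<open>\<phi>\<close>, so a multiple of \<open>p\<close>
  represents \<open>\<phi>\<close>. With uniqueness this justifies the \<open>THE\<close> in
  \<open>riesz\<close>.\<close>

lemma riesz_apply:
  fixes \<phi> :: "'a::{real_inner,complete_space} \<Rightarrow>\<^sub>L real"
  shows "blinfun_apply \<phi> h = riesz \<phi> \<bullet> h"
proof -
  have "\<exists>z. \<forall>h. blinfun_apply \<phi> h = z \<bullet> h"
  proof (cases "\<phi> = 0")
    case True
    then show ?thesis by (intro exI[of _ 0]) simp
  next
    case False
    then obtain k where k: "blinfun_apply \<phi> k \<noteq> 0"
      by (metis blinfun_eqI zero_blinfun.rep_eq)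
    define H where "H = {z. blinfun_apply \<phi> z = 1}"
    have H: "closed H" "convex H" "H \<noteq> {}"
    proof -
      show "closed H" unfolding H_def by (intro closed_Collect_eq continuous_intros)
      show "convex H" unfolding H_def
        by (auto simp: convex_def blinfun.add_right blinfun.scaleR_right)
      have "(1 / blinfun_apply \<phi> k) *\<^sub>R k \<in> H" using k by (simp add: H_def blinfun.scaleR_right)
      then show "H \<noteq> {}" by blast
    qed
    obtain p where p: "p \<in> H" "\<forall>c\<in>H. dist 0 p \<le> dist 0 c"
      using distance_attains_inf_complete[OF H] by blast
    have ker: "p \<bullet> h = 0" if "blinfun_apply \<phi> h = 0" for h
    proof -
      \<comment> \<open>Moving along the kernel in both directions stays in \<open>H\<close>, so the
        obtuse-angle condition holds with both signs and becomes an equality.\<close>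
      have "p + h \<in> H" "p - h \<in> H"
        using p that by (auto simp: H_def blinfun.add_right blinfun.diff_right)
      then have "(0 - p) \<bullet> (p + h - p) \<le> 0" "(0 - p) \<bullet> (p - h - p) \<le> 0"
        by - (rule any_closest_point_dot[OF H(2,1) p(1) _ p(2)], assumption)+
      then show ?thesis by simp
    qed
    have p0: "p \<bullet> p \<noteq> 0" using p by (auto simp: H_def blinfun.zero_right)
    show ?thesis
    proof (intro exI allI)
      fix h
      have "p \<bullet> (h - blinfun_apply \<phi> h *\<^sub>R p) = 0"
        using p by (intro ker) (simp add: H_def blinfun.diff_right blinfun.scaleR_right)
      then show "blinfun_apply \<phi> h = ((1 / (p \<bullet> p)) *\<^sub>R p) \<bullet> h"
        using p0 by (simp add: inner_diff_right field_simps)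
    qed
  qed
  then have "\<exists>!z. \<forall>h. blinfun_apply \<phi> h = z \<bullet> h"
    by (auto simp: vector_eq_rdot)
  from theI'[OF this] show ?thesis unfolding riesz_def by blast
qed

section \<open>Partial derivatives and partial tangent inequalities\<close>

lemma frechet_dual_apply:
  assumes "(g has_derivative D) (at z)"
  shows "blinfun_apply (frechet_dual g z) h = D h"
proof -
  have "frechet_derivative g (at z) = D" using frechet_derivative_at[OF assms] by simp
  then show ?thesis
    using has_derivative_bounded_linear[OF assms]
    by (simp add: frechet_dual_def bounded_linear_Blinfun_apply)
qed

lemma bidual_embedding_apply: "blinfun_apply (bidual_embedding p) \<phi> = blinfun_apply \<phi> p"
proof -
  have "bounded_linear (\<lambda>\<phi>. blinfun_apply \<phi> p)" by (rule blinfun.bounded_linear_left)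
  then show ?thesis by (simp add: bidual_embedding_def bounded_linear_Blinfun_apply)
qed

text \<open>As \<open>f\<close> is quadratic in \<open>(y, u)\<close>, the gap between the two sides
  is exactly its second-order term, a sum of nonnegative squares.\<close>

lemma lower_objective_ge_tangent:
  fixes J :: "'y::real_normed_vector \<Rightarrow>\<^sub>L 'v::real_inner"
    and E :: "'x::real_normed_vector \<Rightarrow>\<^sub>L 'v" and u :: "'u::{real_inner,complete_space}"
  assumes "\<sigma> \<ge> 0"
  defines "f \<equiv> lower_objective J E \<sigma>"
  shows "f (x, y', u') \<ge> f (x, y, u) + blinfun_apply (deriv_y f x y u) (y' - y)
    + deriv_u f x y u \<bullet> (u' - u)"
proof -
  let ?r = "blinfun_apply J y - blinfun_apply E x"
  have f: "f (x, y, u) = 1/2 * ((blinfun_apply J y - blinfun_apply E x) \<bullet>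
      (blinfun_apply J y - blinfun_apply E x)) + \<sigma>/2 * (u \<bullet> u)" for x y u
    by (simp add: f_def lower_objective_def power2_norm_eq_inner)
  have "((\<lambda>y. f (x, y, u)) has_derivative (\<lambda>h. ?r \<bullet> blinfun_apply J h)) (at y)"
    unfolding f by (auto intro!: derivative_eq_intros simp: fun_eq_iff inner_commute)
  then have y: "blinfun_apply (deriv_y f x y u) h = ?r \<bullet> blinfun_apply J h" for h
    unfolding deriv_y_def by (rule frechet_dual_apply)
  have "((\<lambda>u. f (x, y, u)) has_derivative (\<lambda>h. \<sigma> * (u \<bullet> h))) (at u)"
    unfolding f by (auto intro!: derivative_eq_intros simp: fun_eq_iff inner_commute)
  then have u: "deriv_u f x y u \<bullet> h = \<sigma> * (u \<bullet> h)" for h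
    unfolding deriv_u_def riesz_apply[symmetric] by (rule frechet_dual_apply)
  have "f (x, y', u') - (f (x, y, u) + blinfun_apply (deriv_y f x y u) (y' - y)
      + deriv_u f x y u \<bullet> (u' - u))
    = 1/2 * (norm (blinfun_apply J (y' - y)))\<^sup>2 + \<sigma>/2 * (norm (u' - u))\<^sup>2"
    unfolding f y u power2_norm_eq_inner
    by (simp add: blinfun.diff_right algebra_simps inner_commute)
  moreover have "\<dots> \<ge> 0" using assms by simp
  ultimately show ?thesis by linarith
qed

text \<open>The partial derivatives are \<open>D\<close> on the coordinate directions. With
  \<open>x\<close> unchanged, only the \<open>y\<close> and \<open>u\<close> terms of the full
  tangent inequality survive.\<close>

lemma convex_ge_partial_tangent:
  fixes F :: "'x::real_normed_vector \<times> 'y::real_normed_vector \<times> 'u::{real_inner,complete_space} \<Rightarrow> real"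
  assumes conv: "convex_on UNIV F" and der: "(F has_derivative D) (at (x, y, u))"
  shows "F (x, y', u') \<ge> F (x, y, u) + blinfun_apply (deriv_y F x y u) (y' - y)
    + deriv_u F x y u \<bullet> (u' - u)"
proof -
  interpret D: bounded_linear D using der by (rule has_derivative_bounded_linear)
  have "((\<lambda>y. F (x, y, u)) has_derivative (\<lambda>h. D (0, h, 0))) (at y)"
    by (rule has_derivative_compose[of "\<lambda>y. (x, y, u)"]) (auto intro!: derivative_eq_intros der)
  then have y: "blinfun_apply (deriv_y F x y u) h = D (0, h, 0)" for h
    unfolding deriv_y_def by (rule frechet_dual_apply)
  have "((\<lambda>u. F (x, y, u)) has_derivative (\<lambda>h. D (0, 0, h))) (at u)"
    by (rule has_derivative_compose[of "\<lambda>u. (x, y, u)"]) (auto intro!: derivative_eq_intros der)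
  then have u: "deriv_u F x y u \<bullet> h = D (0, 0, h)" for h
    unfolding deriv_u_def riesz_apply[symmetric] by (rule frechet_dual_apply)
  have "D ((x, y', u') - (x, y, u)) = D (0, y' - y, 0) + D (0, 0, u' - u)"
    by (simp flip: D.add)
  then show ?thesis
    using convex_on_ge_tangent[OF conv der, of "(x, y', u')"] by (simp add: y u)
qed

section \<open>Global optimality from the KKT system\<close>

text \<open>The KKT equations are paired with the feasible direction \<open>(h, g)\<close>. The
  \<open>lp\<close> terms cancel and the normal cone gives \<open>lu\<close> a favourable sign, so
  the first-order terms of both tangent inequalities together are nonnegative.\<close>

lemma penalty_kkt_imp_minimizer:
  fixes F :: "'x::real_normed_vector \<times> 'y::{real_inner,complete_space} \<times> 'u::{real_inner,complete_space} \<Rightarrow> real"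
    and J :: "'y \<Rightarrow>\<^sub>L 'v::real_inner" and E :: "'x \<Rightarrow>\<^sub>L 'v"
  assumes "C1_frechet F" "convex_on UNIV F" "\<sigma> \<ge> 0" "\<alpha> \<ge> 0"
  defines "f \<equiv> lower_objective J E \<sigma>"
  assumes kkt: "penalty_kkt F f A B U \<alpha> x y u lp lu"
    and z: "(y', u') \<in> lower_feasible A B U"
  shows "F (x, y, u) + \<alpha> * f (x, y, u) \<le> F (x, y', u') + \<alpha> * f (x, y', u')"
proof -
  obtain D where D: "(F has_derivative blinfun_apply (D (x, y, u))) (at (x, y, u))"
    using assms(1) by (auto simp: C1_frechet_def)
  define h where "h = y' - y"
  define g where "g = u' - u"
  have ky: "0 = deriv_y F x y u + dual_operator A (bidual_embedding lp) + \<alpha> *\<^sub>R deriv_y f x y u"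
    and ku: "0 = deriv_u F x y u - riesz (dual_operator B (bidual_embedding lp)) + lu
           + \<alpha> *\<^sub>R deriv_u f x y u"
    and feas: "blinfun_apply A y = blinfun_apply B u"
    and nc: "lu \<in> normal_cone U u"
    using kkt by (auto simp: penalty_kkt_def)
  have lu: "lu \<bullet> g \<le> 0"
    using nc z by (auto simp: normal_cone_def g_def lower_feasible_def split: if_splits)
  have "blinfun_apply (deriv_y F x y u + dual_operator A (bidual_embedding lp)
      + \<alpha> *\<^sub>R deriv_y f x y u) h = 0"
    unfolding ky[symmetric] by simp
  then have 1: "blinfun_apply (deriv_y F x y u) h + blinfun_apply (blinfun_apply A h) lp
      + \<alpha> * blinfun_apply (deriv_y f x y u) h = 0"
    by (simp add: blinfun.add_left blinfun.scaleR_left dual_operator_def bidual_embedding_apply)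
  have "(deriv_u F x y u - riesz (dual_operator B (bidual_embedding lp)) + lu
           + \<alpha> *\<^sub>R deriv_u f x y u) \<bullet> g = 0"
    unfolding ku[symmetric] by simp
  then have 2: "deriv_u F x y u \<bullet> g - blinfun_apply (blinfun_apply B g) lp + lu \<bullet> g
      + \<alpha> * (deriv_u f x y u \<bullet> g) = 0"
    by (simp add: inner_add_left inner_diff_left riesz_apply[symmetric] dual_operator_def
        bidual_embedding_apply)
  \<comment> \<open>The difference of two feasible points solves the state equation, which makes the
    \<open>lp\<close> terms of \<open>1\<close> and \<open>2\<close> cancel when added.\<close>
  have 3: "blinfun_apply A h = blinfun_apply B g"
    using feas z by (simp add: h_def g_def blinfun.diff_right lower_feasible_def)
  have 4: "F (x, y', u') \<ge> F (x, y, u) + blinfun_apply (deriv_y F x y u) h + deriv_u F x y u \<bullet> g"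
    unfolding h_def g_def using assms(2) D by (rule convex_ge_partial_tangent)
  have "f (x, y', u') \<ge> f (x, y, u) + blinfun_apply (deriv_y f x y u) h + deriv_u f x y u \<bullet> g"
    unfolding h_def g_def f_def using assms(3) by (rule lower_objective_ge_tangent)
  from mult_left_mono[OF this assms(4)] 1 2 3 4 lu show ?thesis
    by (simp add: algebra_simps)
qed

section \<open>The lower-level problem as a metric projection\<close>

text \<open>
  Up to the factor \<open>1/2\<close>, the reduced lower-level objective is the squared distance from \<open>(E x, 0)\<close> to
  the point \<open>(T u, \<surd>\<sigma> u)\<close> of \<open>'v \<times> 'u\<close>, where \<open>T\<close> maps \<open>u\<close> to the embedded state.  The lower-level
  problem is therefore a metric projection, which is nonexpansive.
\<close>

lemma lower_solution_minimizes_continuous: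
  fixes J :: "'y::real_normed_vector \<Rightarrow>\<^sub>L 'v::{real_inner,complete_space}"
    and E :: "'x::real_normed_vector \<Rightarrow>\<^sub>L 'v"
    and B :: "'u::{real_inner,complete_space} \<Rightarrow>\<^sub>L ('y \<Rightarrow>\<^sub>L real)"
  assumes A: "isomorphism A" and U: "U \<noteq> {}" "closed U" "convex U" and \<sigma>: "\<sigma> > 0"
  defines "f \<equiv> lower_objective J E \<sigma>" and "S \<equiv> lower_feasible A B U"
  shows "lower_solution f S x \<in> S"
    and "\<forall>z\<in>S. f (x, lower_solution f S x) \<le> f (x, z)"
    and "continuous_on UNIV (lower_solution f S)"
proof -
  obtain R where R: "R o\<^sub>L A = id_blinfun" "A o\<^sub>L R = id_blinfun"
    using A by (auto simp: isomorphism_def)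
  define M where "M = R o\<^sub>L B"
  define T where "T = J o\<^sub>L M"
  define s where "s = sqrt \<sigma>"
  have s: "s > 0" "s\<^sup>2 = \<sigma>" using \<sigma> by (auto simp: s_def)
  have RA: "blinfun_apply R (blinfun_apply A y) = y" and AR: "blinfun_apply A (blinfun_apply R b) = b"
    for y b
    using R by (metis blinfun_apply_blinfun_compose id_blinfun.rep_eq id_apply)+
  \<comment> \<open>The feasible set is the graph over \<open>U\<close> of the control-to-state map
    \<open>M\<close>, the inverse of \<open>A\<close> composed with \<open>B\<close>.\<close>
  have S_iff: "(y, u) \<in> S \<longleftrightarrow> u \<in> U \<and> y = blinfun_apply M u" for y u
    by (auto simp: S_def lower_feasible_def M_def RA AR) (metis RA)
  \<comment> \<open>\<open>K\<close> is the image of \<open>U\<close> under \<open>e\<close>,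
    written with the inverse scaling so that closedness follows from preimages and a continuous
    equation.\<close>
  define K where "K = {p :: 'v \<times> 'u. (1/s) *\<^sub>R snd p \<in> U \<and> fst p = blinfun_apply T ((1/s) *\<^sub>R snd p)}"
  define e where "e u = (blinfun_apply T u, s *\<^sub>R u)" for u
  have e_K: "e u \<in> K \<longleftrightarrow> u \<in> U" for u
    using s by (simp add: e_def K_def)
  have K_e: "e ((1/s) *\<^sub>R snd p) = p" if "p \<in> K" for p
    using s that by (simp add: e_def K_def prod_eq_iff)
  have K: "closed K" "convex K" "K \<noteq> {}"
  proof -
    have "closed ((\<lambda>p :: 'v \<times> 'u. (1/s) *\<^sub>R snd p) -` U)"
      by (rule closed_vimage[OF U(2)]) (intro continuous_intros)
    moreover have "closed {p :: 'v \<times> 'u. fst p = blinfun_apply T ((1/s) *\<^sub>R snd p)}"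
      by (intro closed_Collect_eq continuous_intros)
    ultimately have "closed ((\<lambda>p :: 'v \<times> 'u. (1/s) *\<^sub>R snd p) -` U
        \<inter> {p. fst p = blinfun_apply T ((1/s) *\<^sub>R snd p)})" by (rule closed_Int)
    then show "closed K" by (simp add: K_def vimage_def Collect_conj_eq)
    have "linear e"
      by (rule linearI) (auto simp: e_def blinfun.add_right blinfun.scaleR_right algebra_simps)
    moreover have "K = e ` U" using e_K K_e by (force simp: K_def)
    ultimately show "convex K" "K \<noteq> {}" using U by (auto intro: convex_linear_image)
  qed
  have f_dist: "f (x, (blinfun_apply M u, u)) = 1/2 * (dist (blinfun_apply E x, 0) (e u))\<^sup>2" for x u
    using s \<sigma> by (simp add: f_def lower_objective_def e_def dist_norm norm_Pair T_def power_mult_distrib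
        norm_minus_commute[of "blinfun_apply E x"])
  have f_le: "f (x, (blinfun_apply M u, u)) \<le> f (x, (blinfun_apply M u', u')) \<longleftrightarrow>
      dist (blinfun_apply E x, 0) (e u) \<le> dist (blinfun_apply E x, 0) (e u')" for x u u'
    unfolding f_dist by (simp add: abs_le_square_iff[symmetric])
  have "\<forall>a. \<exists>p. p \<in> K \<and> (\<forall>c\<in>K. dist a p \<le> dist a c)"
    using distance_attains_inf_complete[OF K] by blast
  then obtain P where P: "\<And>a. P a \<in> K" "\<And>a. \<forall>c\<in>K. dist a (P a) \<le> dist a c"
    by metis
  define q where "q x = P (blinfun_apply E x, 0)" for x
  have q: "q x \<in> K" "\<forall>c\<in>K. dist (blinfun_apply E x, 0) (q x) \<le> dist (blinfun_apply E x, 0) c" for x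
    unfolding q_def by (rule P)+
  define v where "v x = (1/s) *\<^sub>R snd (q x)" for x
  have e_v: "e (v x) = q x" for x using K_e[OF q(1)] by (simp add: v_def)
  have vU: "v x \<in> U" for x using q(1)[of x] e_K[of "v x"] by (simp add: e_v)
  have min: "(blinfun_apply M (v x), v x) \<in> S"
      "\<forall>z\<in>S. f (x, (blinfun_apply M (v x), v x)) \<le> f (x, z)" for x
    using vU q(2)[of x] by (auto simp: S_iff f_le e_v e_K)
  have sol: "lower_solution f S x = (blinfun_apply M (v x), v x)" for x
    unfolding lower_solution_def
  proof (rule the_equality)
    \<comment> \<open>Any minimiser yields a nearest point of \<open>K\<close>. Such a point is
      unique, and \<open>e\<close> is injective because \<open>s\<close> is positive.\<close>
    fix z assume z: "z \<in> S \<and> (\<forall>z'\<in>S. f (x, z) \<le> f (x, z'))"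
    obtain u where u: "z = (blinfun_apply M u, u)" "u \<in> U"
      using z by (cases z) (auto simp: S_iff)
    have "\<forall>c\<in>K. dist (blinfun_apply E x, 0) (e u) \<le> dist (blinfun_apply E x, 0) c"
    proof
      fix c assume c: "c \<in> K"
      then have "(1/s) *\<^sub>R snd c \<in> U" by (simp add: K_def)
      then have "f (x, z) \<le> f (x, (blinfun_apply M ((1/s) *\<^sub>R snd c), (1/s) *\<^sub>R snd c))"
        using z by (auto simp: S_iff)
      then show "dist (blinfun_apply E x, 0) (e u) \<le> dist (blinfun_apply E x, 0) c"
        unfolding u f_le K_e[OF c] .
    qed
    then have "e u = q x"
      using K q u by (intro any_closest_point_unique[of K]) (auto simp: e_K)
    then have "u = v x" using s by (auto simp: v_def e_def dest: sym)
    then show "z = (blinfun_apply M (v x), v x)" by (simp add: u)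
  qed (use min in auto)
  show "lower_solution f S x \<in> S" "\<forall>z\<in>S. f (x, lower_solution f S x) \<le> f (x, z)"
    using min by (simp_all add: sol)
  have "1-lipschitz_on UNIV P"
    using closest_points_nonexpansive[OF K(2,1) P P] by (intro lipschitz_onI) auto
  then have "continuous_on UNIV P" by (rule lipschitz_on_continuous_on)
  then have "continuous_on UNIV q"
    unfolding q_def by (rule continuous_on_compose2) (auto intro!: continuous_intros)
  then show "continuous_on UNIV (lower_solution f S)"
    unfolding sol v_def by (intro continuous_intros)
qed

section \<open>Bounding the penalty parameters\<close>

theorem mainTheorem2:
  fixes F :: "(real^'n) \<times> 'y::{real_inner,complete_space} \<times> 'u::{real_inner,complete_space} \<Rightarrow> real"
    and A :: "'y \<Rightarrow>\<^sub>L ('y \<Rightarrow>\<^sub>L real)"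
    and B :: "'u \<Rightarrow>\<^sub>L ('y \<Rightarrow>\<^sub>L real)"
    and E :: "(real^'n) \<Rightarrow>\<^sub>L 'v::{real_inner,complete_space}"
    and J :: "'y \<Rightarrow>\<^sub>L 'v"
    and Xad :: "(real^'n) set" and Uad :: "'u set"
    and \<sigma> \<epsilon> \<gamma> \<eta> \<kappa> :: real
    and x :: "nat \<Rightarrow> real^'n" and y lp :: "nat \<Rightarrow> 'y" and u lu :: "nat \<Rightarrow> 'u"
    and \<alpha> :: "nat \<Rightarrow> real"
  assumes "inj (blinfun_apply J)"
    and "C1_frechet F" and "convex_on UNIV F"
    and "Xad \<noteq> {}" and "convex Xad" and "compact Xad"
    and "isomorphism A"
    and "Uad \<noteq> {}" and "closed Uad" and "convex Uad" and "bounded Uad"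
    and "\<sigma> > 0" and "\<epsilon> > 0"
    and "x 0 \<in> Xad" and "\<alpha> 0 > 0" and "\<gamma> > 1" and "\<eta> > 0" and "0 < \<kappa>" and "\<kappa> < 1"
    and "penalty_run F A B E J Xad Uad \<sigma> \<epsilon> \<gamma> \<eta> \<kappa> x y u lp lu \<alpha>"
  shows "bounded (range \<alpha>) \<and> convergent \<alpha>"
proof -
  define f :: "(real^'n) \<times> 'y \<times> 'u \<Rightarrow> real" where "f = lower_objective J E \<sigma>"
  define S where "S = lower_feasible A B Uad"
  define L where "L = lower_solution f S"
  note run = assms(20)[unfolded penalty_run_def Let_def, folded f_def S_def]
  have kkt: "penalty_kkt F f A B Uad (\<alpha> k) (x k) (y k) (u k) (lp k) (lu k)"
    and V: "f (x k, y k, u k) - f (x k, L (x k)) > \<epsilon>" for k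
    using run by (auto simp: L_def lower_value_def)
  \<comment> \<open>In either branch the factor is at least 1, which yields positivity and
    monotonicity.\<close>
  have \<alpha>_Suc: "\<alpha> (Suc k) = \<gamma> * \<alpha> k \<or> \<alpha> (Suc k) = \<alpha> k" for k
    using run[THEN spec, of k] by (simp split: if_splits)
  have \<alpha>_pos: "\<alpha> k > 0" for k
  proof (induction k)
    case (Suc k)
    then show ?case using \<alpha>_Suc[of k] \<open>\<gamma> > 1\<close> by auto
  qed (fact \<open>\<alpha> 0 > 0\<close>)
  have "\<alpha> k \<le> \<alpha> (Suc k)" for k
    using \<alpha>_Suc[of k] \<alpha>_pos[of k] \<open>\<gamma> > 1\<close> by auto
  then have inc: "incseq \<alpha>" by (rule incseq_SucI)
  have xX: "x k \<in> Xad" for k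
  proof (cases k)
    case (Suc j)
    then show ?thesis
      using run[THEN spec, of j]
        closest_point_in_set[OF compact_imp_closed[OF \<open>compact Xad\<close>] \<open>Xad \<noteq> {}\<close>]
      by simp
  qed (use \<open>x 0 \<in> Xad\<close> in simp)
  have L: "L x \<in> S" "continuous_on UNIV L" for x
    using lower_solution_minimizes_continuous[OF assms(7,8,9,10,12), where J = J and E = E and B = B]
    by (simp_all add: L_def f_def S_def)
  obtain D where D: "\<And>z. (F has_derivative blinfun_apply (D z)) (at z)"
    using \<open>C1_frechet F\<close> by (auto simp: C1_frechet_def)
  have F_cont: "continuous_on UNIV F"
    using has_derivative_continuous[OF D] by (intro continuous_at_imp_continuous_on ballI)
  have "continuous_on Xad (\<lambda>x. F (x, L x))"
    by (intro continuous_on_compose2[OF F_cont] continuous_intros continuous_on_subset[OF L(2)]) auto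
  then obtain m where m: "\<And>x. x \<in> Xad \<Longrightarrow> F (x, L x) \<le> F (m, L m)"
    using continuous_attains_sup[OF \<open>compact Xad\<close> \<open>Xad \<noteq> {}\<close>] by blast
  have "\<exists>b. \<forall>k. b \<le> F (x k, y k, u k)"
  proof -
    obtain R where R: "R o\<^sub>L A = id_blinfun"
      using \<open>isomorphism A\<close> by (auto simp: isomorphism_def)
    \<comment> \<open>The states are the image of controls in the bounded set \<open>Uad\<close>
      under one bounded operator, so all iterates lie in a bounded set.\<close>
    have y: "y k = blinfun_apply (R o\<^sub>L B) (u k)" and uU: "u k \<in> Uad" for k
    proof -
      have "blinfun_apply A (y k) = blinfun_apply B (u k)"
        using kkt[of k] by (simp add: penalty_kkt_def)
      moreover have "blinfun_apply R (blinfun_apply A (y k)) = y k"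
        using R by (metis blinfun_apply_blinfun_compose id_blinfun.rep_eq id_apply)
      ultimately show "y k = blinfun_apply (R o\<^sub>L B) (u k)" by simp
      show "u k \<in> Uad"
        using kkt[of k] by (auto simp: penalty_kkt_def normal_cone_def split: if_splits)
    qed
    have "bounded (blinfun_apply (R o\<^sub>L B) ` Uad)"
      using \<open>bounded Uad\<close> by (rule bounded_linear_image) (rule blinfun.bounded_linear_right)
    then have "bounded (Xad \<times> blinfun_apply (R o\<^sub>L B) ` Uad \<times> Uad)"
      using \<open>bounded Uad\<close> compact_imp_bounded[OF \<open>compact Xad\<close>] by (intro bounded_Times)
    then obtain c where c: "\<And>z. z \<in> Xad \<times> blinfun_apply (R o\<^sub>L B) ` Uad \<times> Uad \<Longrightarrow> norm z \<le> c"
      by (auto simp: bounded_iff)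
    show ?thesis
    proof (intro exI allI)
      fix k
      let ?z = "(x k, y k, u k)"
      have "norm ?z \<le> c" using xX uU y by (intro c) auto
      then have "norm (D 0) * norm ?z \<le> norm (D 0) * c" by (intro mult_left_mono) auto
      moreover have "\<bar>blinfun_apply (D 0) ?z\<bar> \<le> norm (D 0) * norm ?z"
        using norm_blinfun[of "D 0" ?z] by simp
      \<comment> \<open>The affine minorant is the tangent at the origin; its slope
        \<open>D 0\<close> does not depend on \<open>k\<close>.\<close>
      moreover have "F ?z \<ge> F 0 + blinfun_apply (D 0) (?z - 0)"
        using \<open>convex_on UNIV F\<close> D by (rule convex_on_ge_tangent)
      then have "F ?z \<ge> F 0 + blinfun_apply (D 0) ?z" by simp
      ultimately show "F 0 - norm (D 0) * c \<le> F ?z" by linarith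
    qed
  qed
  then obtain b where b: "\<And>k. b \<le> F (x k, y k, u k)" by blast
  \<comment> \<open>The lower-level solution at \<open>x k\<close> serves as the competitor;
    \<open>m\<close> and \<open>b\<close> make the bound uniform in \<open>k\<close>.\<close>
  have \<alpha>_le: "\<alpha> k \<le> (F (m, L m) - b) / \<epsilon>" for k
  proof -
    obtain y' u' where z: "L (x k) = (y', u')" by (cases "L (x k)")
    have "F (x k, y k, u k) + \<alpha> k * f (x k, y k, u k) \<le> F (x k, y', u') + \<alpha> k * f (x k, y', u')"
      unfolding f_def
      by (rule penalty_kkt_imp_minimizer[OF assms(2,3)])
        (use \<open>\<sigma> > 0\<close> \<alpha>_pos[of k] kkt[of k] L(1)[of "x k"] z in \<open>auto simp: f_def S_def\<close>)
    moreover have "\<alpha> k * \<epsilon> \<le> \<alpha> k * (f (x k, y k, u k) - f (x k, y', u'))"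
      using V[of k] \<alpha>_pos[of k] z by (intro mult_left_mono) auto
    ultimately have "\<alpha> k * \<epsilon> \<le> F (m, L m) - b"
      using m[OF xX, of k] b[of k] z by (simp add: algebra_simps)
    then show ?thesis using \<open>\<epsilon> > 0\<close> by (simp add: pos_le_divide_eq)
  qed
  then have "bounded (range \<alpha>)"
    using \<alpha>_pos by (intro boundedI[of _ "(F (m, L m) - b) / \<epsilon>"]) (auto simp: less_imp_le)
  moreover have "convergent \<alpha>"
    using incseq_convergent[OF inc] \<alpha>_le by (metis convergentI)
  ultimately show ?thesis by blast
qed

end
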